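(* Let $f:\mathbb{N}\to\mathbb{N}$, let $p$ be a prime, and let $n$ and $m$ be nonnegative integers. Define $g:\mathbb{N}\to\mathbb{N}$ by $g(r)=\binom{p}{rp}_{f}$ for all $r\in\mathbb{N}$. Then $$\binom{np}{mp}_{f} \equiv \binom{n}{m}_{g}\pmod{p^2}.$$
   Context: $\mathbb{N}=\{0,1,2,\dots\}$. For any function $h:\mathbb{N}\to\mathbb{N}$ and integers $k,n\ge 0$, the extended binomial coefficient $\binom{k}{n}_{h}$ is the coefficient of $x^n$ in the formal power series $\bigl(\sum_{s\in\mathbb{N}} h(s)x^s\bigr)^k$. *)

theory Defs
  imports "HOL-Computational_Algebra.Formal_Power_Series" "HOL-Number_Theory.Cong"
begin

definition ext_binomial :: "(nat \<Rightarrow> nat) \<Rightarrow> nat \<Rightarrow> nat \<Rightarrow> nat" where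
  "ext_binomial h k n = fps_nth (Abs_fps h ^ k) n"

end

theory Submission
  imports Defs
begin

text \<open>
  Let \<open>F = \<Sum>s. f s x\<^sup>s\<close>.  As \<open>(F\<^sup>p)' = p F\<^bsup>p-1\<^esup> F'\<close>, a coefficient of \<open>F\<^sup>p\<close> whose index is not divisible
  by \<open>p\<close> is a multiple of \<open>p\<close>.  Hence \<open>F\<^sup>p = G(x\<^sup>p) + p H\<close> with \<open>G\<close> the generating series of \<open>g\<close> and
  \<open>H\<close> supported on the non-multiples of \<open>p\<close>.  Modulo \<open>p\<^sup>2\<close> this gives
  \<open>F\<^bsup>np\<^esup> = G(x\<^sup>p)\<^sup>n + n p G(x\<^sup>p)\<^bsup>n-1\<^esup> H\<close>, whose last term has no monomials \<open>x\<^bsup>mp\<^esup>\<close>.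
\<close>

text \<open>The series \<open>a(x^p)\<close>, given by its coefficients.\<close>

definition fps_stretch :: "nat \<Rightarrow> 'a::zero fps \<Rightarrow> 'a fps" where
  "fps_stretch p a = Abs_fps (\<lambda>k. if p dvd k then fps_nth a (k div p) else 0)"

lemma fps_stretch_nth [simp]:
  "fps_nth (fps_stretch p a) k = (if p dvd k then fps_nth a (k div p) else 0)"
  by (simp add: fps_stretch_def)

text \<open>In the convolution only the indices \<open>j = i * p\<close> contribute.\<close>

lemma fps_stretch_mult_nth:
  fixes a b :: "'a::comm_semiring_1 fps"
  assumes "p > 0"
  shows "fps_nth (fps_stretch p a * b) k = (\<Sum>i=0..k div p. fps_nth a i * fps_nth b (k - i * p))"
proof -
  have "fps_nth (fps_stretch p a * b) k
      = (\<Sum>j\<in>{0..k}. (if p dvd j then fps_nth a (j div p) else 0) * fps_nth b (k - j))"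
    by (simp add: fps_mult_nth)
  also have "\<dots> = (\<Sum>j\<in>(\<lambda>i. i * p) ` {0..k div p}.
      (if p dvd j then fps_nth a (j div p) else 0) * fps_nth b (k - j))"
  proof (rule sum.mono_neutral_right)
    show "(\<lambda>i. i * p) ` {0..k div p} \<subseteq> {0..k}"
      using assms by (auto simp: less_eq_div_iff_mult_less_eq)
    show "\<forall>j\<in>{0..k} - (\<lambda>i. i * p) ` {0..k div p}.
        (if p dvd j then fps_nth a (j div p) else 0) * fps_nth b (k - j) = 0"
      by (auto elim!: dvdE simp: image_iff)
        (metis assms atLeastAtMost_iff div_le_mono le0 mult.commute nonzero_mult_div_cancel_left
          less_numeral_extra(3))
  qed simp
  also have "\<dots> = (\<Sum>i=0..k div p. fps_nth a i * fps_nth b (k - i * p))"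
    using assms by (subst sum.reindex) (auto simp: inj_on_def)
  finally show ?thesis .
qed

lemma fps_stretch_mult:
  fixes a b :: "'a::comm_semiring_1 fps"
  assumes "p > 0"
  shows "fps_stretch p (a * b) = fps_stretch p a * fps_stretch p b"
proof (rule fps_ext)
  fix k
  \<comment> \<open>The bound on \<open>i\<close> gives \<open>i * p \<le> k\<close>, so the
    subtraction on naturals is exact.\<close>
  have dvd: "p dvd k - i * p \<longleftrightarrow> p dvd k" and div: "(k - i * p) div p = k div p - i"
    if "i \<le> k div p" for i
  proof -
    have "i * p \<le> k" using that assms by (simp add: less_eq_div_iff_mult_less_eq)
    then show "p dvd k - i * p \<longleftrightarrow> p dvd k"
      by (metis dvd_diffD dvd_diff_nat dvd_triv_right)
    show "(k - i * p) div p = k div p - i"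
      using \<open>i * p \<le> k\<close> assms
      by (metis div_mult_self3 diff_add_inverse le_add_diff_inverse add.commute less_numeral_extra(3))
  qed
  show "fps_nth (fps_stretch p (a * b)) k = fps_nth (fps_stretch p a * fps_stretch p b) k"
    using dvd div unfolding fps_stretch_mult_nth[OF assms] by (auto simp: fps_mult_nth intro!: sum.cong)
qed

lemma fps_stretch_power:
  fixes a :: "'a::comm_semiring_1 fps"
  assumes "p > 0"
  shows "fps_stretch p (a ^ n) = fps_stretch p a ^ n"
proof (induction n)
  case 0
  then show ?case using assms by (auto simp: fps_eq_iff)
next
  case (Suc n)
  then show ?case by (simp add: fps_stretch_mult[OF assms])
qed

lemma prime_dvd_fps_power_nth:
  fixes F :: "nat fps"
  assumes "prime p" "\<not> p dvd k"
  shows "p dvd fps_nth (F ^ p) k"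
proof -
  \<comment> \<open>\<open>k\<close> is nonzero as \<open>p\<close> divides 0; coefficient
    \<open>j\<close> of the derivative carries the factor \<open>Suc j = k\<close>.\<close>
  obtain j where k: "k = Suc j" using assms(2) by (cases k) auto
  have "k * fps_nth (F ^ p) k = fps_nth (fps_deriv (F ^ p)) j"
    by (simp add: k)
  also have "\<dots> = p * fps_nth (fps_deriv F * F ^ (p - 1)) j"
    by (simp add: fps_deriv_power mult.assoc)
  finally have "p dvd k * fps_nth (F ^ p) k" by simp
  with assms show ?thesis by (simp add: prime_dvd_mult_iff)
qed

lemma fps_stretch_add_mult_power:
  fixes G H :: "'a::comm_semiring_1 fps"
  assumes "p > 0" "\<And>k. p dvd k \<Longrightarrow> fps_nth H k = 0"
  shows "\<exists>B K. (fps_stretch p G + fps_const c * H) ^ n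
        = fps_stretch p (G ^ n) + fps_const c * B + fps_const (c\<^sup>2) * K
      \<and> (\<forall>k. p dvd k \<longrightarrow> fps_nth B k = 0)"
proof (induction n)
  case 0
  have "(fps_stretch p G + fps_const c * H) ^ 0
        = fps_stretch p (G ^ 0) + fps_const c * 0 + fps_const (c\<^sup>2) * 0"
    by (simp add: fps_stretch_power[OF assms(1)] del: power_0) simp
  then show ?case by (metis fps_zero_nth)
next
  case (Suc n)
  then obtain B K where IH: "(fps_stretch p G + fps_const c * H) ^ n
        = fps_stretch p (G ^ n) + fps_const c * B + fps_const (c\<^sup>2) * K"
    and B: "\<And>k. p dvd k \<Longrightarrow> fps_nth B k = 0" by blast
  \<comment> \<open>A factor in \<open>x^p\<close> shifts exponents by multiples of
    \<open>p\<close>, so it preserves vanishing at those multiples.\<close>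
  have off: "fps_nth (fps_stretch p a * b) k = 0"
    if "p dvd k" "\<And>k. p dvd k \<Longrightarrow> fps_nth b k = 0" for a b :: "'a fps" and k
    unfolding fps_stretch_mult_nth[OF assms(1)] using that
    by (intro sum.neutral) (simp add: dvd_diff_nat)
  \<comment> \<open>With \<open>S = fps_stretch p G\<close>, sort
    \<open>(S + c H) (S^n + c B + c^2 K)\<close> by powers of \<open>c\<close>; \<open>?K\<close>
    absorbs the cubic term.\<close>
  let ?B = "fps_stretch p G * B + fps_stretch p (G ^ n) * H"
  let ?K = "H * B + fps_stretch p G * K + fps_const c * H * K"
  have "(fps_stretch p G + fps_const c * H) ^ Suc n
      = fps_stretch p (G ^ Suc n) + fps_const c * ?B + fps_const (c\<^sup>2) * ?K"
    unfolding power_Suc IH fps_stretch_mult[OF assms(1)]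
    by (simp add: algebra_simps power2_eq_square flip: fps_const_mult)
  moreover have "\<forall>k. p dvd k \<longrightarrow> fps_nth ?B k = 0"
    using off[OF _ B] off[OF _ assms(2)] by simp
  ultimately show ?case by blast
qed

theorem theorem14:
  fixes f g :: "nat \<Rightarrow> nat" and p n m :: nat
  assumes "prime p"
    and "\<And>r. g r = ext_binomial f p (r * p)"
  shows "[ext_binomial f (n * p) (m * p) = ext_binomial g n m] (mod p\<^sup>2)"
proof -
  have p: "p > 0" using assms(1) by (rule prime_gt_0_nat)
  define F G where "F = Abs_fps f" and "G = Abs_fps g"
  \<comment> \<open>The division by \<open>p\<close> is exact off the multiples of \<open>p\<close>;
    at \<open>r * p\<close> the coefficient of \<open>F ^ p\<close> is \<open>g r\<close>, left to
    \<open>G\<close>.\<close>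
  define H where "H = Abs_fps (\<lambda>k. if p dvd k then 0 else fps_nth (F ^ p) k div p)"
  have split: "F ^ p = fps_stretch p G + fps_const p * H"
    using prime_dvd_fps_power_nth[OF assms(1)] 
    by (auto simp: fps_eq_iff G_def H_def F_def assms(2) ext_binomial_def)
  obtain B K where BK: "(F ^ p) ^ n = fps_stretch p (G ^ n) + fps_const p * B + fps_const (p\<^sup>2) * K"
    and B: "\<And>k. p dvd k \<Longrightarrow> fps_nth B k = 0"
    using fps_stretch_add_mult_power[OF p, of H G p n] unfolding split by (auto simp: H_def)
  have "ext_binomial f (n * p) (m * p) = fps_nth ((F ^ p) ^ n) (m * p)"
    by (simp add: ext_binomial_def F_def mult.commute flip: power_mult)
  \<comment> \<open>At index \<open>m * p\<close> the series \<open>B\<close> vanishes and the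
    stretched \<open>G ^ n\<close> has its coefficient \<open>m\<close>.\<close>
  also have "\<dots> = ext_binomial g n m + p\<^sup>2 * fps_nth K (m * p)"
    unfolding BK using p B by (simp add: ext_binomial_def G_def)
  finally show ?thesis by (simp add: cong_def)
qed

end
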